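(* Let $R$ be an integrally closed integral domain. Then the polynomial ring $R[X]$ is dually compact (DC) if and only if $R$ is dually compact.
   Context: An integral domain $D$ with quotient field $L$ is dually compact (DC) if for every nonempty set $\{a_\alpha\}_{\alpha\in I}\subseteq L\setminus\{0\}$ with $\bigcap_{\alpha\in I}a_\alpha D\neq(0)$ there is a finite set $\{x_1,\dots,x_n\}\subseteq L\setminus\{0\}$ with $\bigcap_{\alpha\in I}a_\alpha D=\bigcap_{i=1}^n x_iD$. *)

theory Defs
  imports "HOL-Computational_Algebra.Polynomial_Factorial"
begin

text \<open>
  An integral domain is the universe of a type of class \<open>idom\<close>, named by a \<open>TYPE('a)\<close> argument.
  Its quotient field is the library type \<open>'a fract\<close>, with the embedding \<open>to_fract\<close>.
\<close>

definition integral_over_domain :: "'a::idom fract \<Rightarrow> bool" where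
  "integral_over_domain x \<longleftrightarrow> (\<exists>p::'a poly. lead_coeff p = 1 \<and> poly (fract_poly p) x = 0)"

definition integrally_closed_domain :: "'a::idom itself \<Rightarrow> bool" where
  "integrally_closed_domain _ \<longleftrightarrow>
     (\<forall>x::'a fract. integral_over_domain x \<longrightarrow> x \<in> range to_fract)"

text \<open>The principal fractional ideal \<open>aD\<close> inside the quotient field of \<open>D\<close>.\<close>

definition principal_fractional_ideal :: "'a::idom fract \<Rightarrow> 'a fract set" where
  "principal_fractional_ideal a = {a * to_fract d | d. True}"

text \<open>
  Both generating sets are nonempty, so that neither intersection is the empty one,
  which would be all of the quotient field.
\<close>

definition dually_compact :: "'a::idom itself \<Rightarrow> bool" where
  "dually_compact _ \<longleftrightarrow>
     (\<forall>A::'a fract set. A \<noteq> {} \<and> A \<subseteq> UNIV - {0} \<and>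
        (\<Inter>a\<in>A. principal_fractional_ideal a) \<noteq> {0} \<longrightarrow>
        (\<exists>B. finite B \<and> B \<noteq> {} \<and> B \<subseteq> UNIV - {0} \<and>
           (\<Inter>a\<in>A. principal_fractional_ideal a) = (\<Inter>x\<in>B. principal_fractional_ideal x)))"

end

theory Submission
  imports Defs
begin

text \<open>
  Over an integrally closed domain \<open>R\<close>, if a constant \<open>c\<close> divides a product \<open>p * q\<close> of polynomials
  then it divides every product of a coefficient of \<open>p\<close> with one of \<open>q\<close>: this is Gauss' lemma in
  each valuation ring containing \<open>R\<close>, and \<open>R\<close> is the intersection of these. For a set \<open>S\<close> of
  polynomials with greatest common divisor \<open>g\<close> over the quotient field, \<open>u S \<subseteq> R[X]\<close> then says that
  \<open>u g\<close> is a polynomial all of whose coefficients lie in one fixed intersection of principal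
  fractional ideals of \<open>R\<close>, determined by the coefficients of the quotients \<open>s / g\<close>.
  Conversely, \<open>u h \<in> R[X]\<close> for a constant \<open>u\<close> is a condition on the finitely many
  coefficients of \<open>h\<close>.
\<close>

section \<open>Valuation subrings of a field\<close>

locale field_subring =
  fixes A :: "'k::field set"
  assumes one_mem: "1 \<in> A"
    and diff_mem: "a \<in> A \<Longrightarrow> b \<in> A \<Longrightarrow> a - b \<in> A"
    and mult_mem: "a \<in> A \<Longrightarrow> b \<in> A \<Longrightarrow> a * b \<in> A"
begin

lemma zero_mem: "0 \<in> A"
  using diff_mem[OF one_mem one_mem] by simp

lemma uminus_mem: "a \<in> A \<Longrightarrow> - a \<in> A"
  using diff_mem[OF zero_mem] by simp

lemma add_mem: "a \<in> A \<Longrightarrow> b \<in> A \<Longrightarrow> a + b \<in> A"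
  using diff_mem[OF _ uminus_mem] by fastforce

lemma sum_mem: "(\<And>i. i \<in> I \<Longrightarrow> f i \<in> A) \<Longrightarrow> sum f I \<in> A"
  by (induction I rule: infinite_finite_induct) (auto intro: zero_mem add_mem)

lemma power_mem: "a \<in> A \<Longrightarrow> a ^ n \<in> A"
  by (induction n) (auto intro: one_mem mult_mem)

lemma poly_mem: "(\<And>i. coeff p i \<in> A) \<Longrightarrow> a \<in> A \<Longrightarrow> poly p a \<in> A"
  by (auto simp: poly_altdef intro!: sum_mem mult_mem power_mem)

definition adjoin :: "'k \<Rightarrow> 'k set" where
  "adjoin t = {poly p t | p. \<forall>i. coeff p i \<in> A}"

lemma field_subring_adjoin: "field_subring (adjoin t)"
proof
  show "1 \<in> adjoin t"
    unfolding adjoin_def by (auto intro!: exI[of _ 1] simp: one_mem zero_mem)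
next
  fix a b assume "a \<in> adjoin t" "b \<in> adjoin t"
  then obtain p q where p: "a = poly p t" "\<forall>i. coeff p i \<in> A"
    and q: "b = poly q t" "\<forall>i. coeff q i \<in> A"
    by (auto simp: adjoin_def)
  show "a - b \<in> adjoin t"
    unfolding adjoin_def using p q
    by (auto intro!: exI[of _ "p - q"] diff_mem)
  show "a * b \<in> adjoin t"
    unfolding adjoin_def using p q
    by (auto intro!: exI[of _ "p * q"] sum_mem mult_mem simp: coeff_mult)
qed

lemma subset_adjoin: "A \<subseteq> adjoin t"
proof
  fix a assume "a \<in> A"
  then show "a \<in> adjoin t"
    unfolding adjoin_def by (auto intro!: exI[of _ "[:a:]"] simp: coeff_pCons zero_mem split: nat.splits)
qed

lemma mem_adjoin_self: "t \<in> adjoin t"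
  unfolding adjoin_def
  by (auto intro!: exI[of _ "[:0, 1:]"] simp: coeff_pCons zero_mem one_mem split: nat.splits)

end

section \<open>Valuation rings and Gauss' lemma over them\<close>

locale valuation_subring = field_subring +
  assumes inverse_mem_cases: "t \<in> A \<or> inverse t \<in> A"
begin

definition nonunits :: "'a set" where
  "nonunits = {t \<in> A. t = 0 \<or> inverse t \<notin> A}"

lemma zero_nonunit: "0 \<in> nonunits"
  by (simp add: nonunits_def zero_mem)

lemma mult_nonunit:
  assumes a: "a \<in> A" and t: "t \<in> nonunits"
  shows "a * t \<in> nonunits"
proof (cases "a = 0 \<or> t = 0")
  case True
  then show ?thesis by (auto simp: zero_nonunit)
next
  case False
  have "inverse t = a * inverse (a * t)"
    using False by (simp add: field_simps)
  then show ?thesis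
    using assms False mult_mem[of a "inverse (a * t)"] by (auto simp: nonunits_def mult_mem simp del: inverse_mult_distrib)
qed

lemma add_nonunit_aux:
  assumes s: "s \<in> nonunits" and t: "t \<in> nonunits" "t \<noteq> 0" and q: "s / t \<in> A"
  shows "s + t \<in> nonunits"
proof -
  have "s + t = (s / t + 1) * t"
    using t by (simp add: field_simps)
  then show ?thesis
    using mult_nonunit[OF add_mem[OF q one_mem] t(1)] by simp
qed

text \<open>One of \<open>s / t\<close> and \<open>t / s\<close> lies in \<open>A\<close>, so the
  sum is an \<open>A\<close>-multiple of \<open>t\<close> or of \<open>s\<close>.\<close>

lemma add_nonunit:
  assumes s: "s \<in> nonunits" and t: "t \<in> nonunits"
  shows "s + t \<in> nonunits"
proof (cases "s = 0 \<or> t = 0")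
  case True
  then show ?thesis using assms by auto
next
  case False
  then show ?thesis
    using inverse_mem_cases[of "s / t"] add_nonunit_aux[OF s t] add_nonunit_aux[OF t s]
    by (auto simp: add.commute)
qed

lemma sum_nonunit: "(\<And>i. i \<in> I \<Longrightarrow> f i \<in> nonunits) \<Longrightarrow> sum f I \<in> nonunits"
  by (induction I rule: infinite_finite_induct) (auto intro: zero_nonunit add_nonunit)

lemma inverse_one_plus_nonunit:
  assumes s: "s \<in> nonunits"
  shows "1 + s \<noteq> 0" "inverse (1 + s) \<in> A"
proof -
  have n1: "1 \<notin> nonunits"
    by (simp add: nonunits_def one_mem)
  have ns: "- s \<in> nonunits"
    using mult_nonunit[OF uminus_mem[OF one_mem] s] by simp
  \<comment> \<open>Otherwise \<open>1 = (1 + s) + (- s)\<close> would be a nonunit.\<close>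
  have "1 + s \<notin> nonunits"
    using add_nonunit[OF _ ns, of "1 + s"] n1 by auto
  moreover have "1 + s \<in> A"
    using s by (auto simp: nonunits_def intro: add_mem one_mem)
  ultimately show "1 + s \<noteq> 0" "inverse (1 + s) \<in> A"
    by (auto simp: nonunits_def)
qed

text \<open>Divisibility is total in a valuation ring; \<open>m\<close> is an element of least
  valuation.\<close>

lemma ex_dominating:
  assumes "finite S" "S \<noteq> {}" "0 \<notin> S"
  shows "\<exists>m\<in>S. \<forall>s\<in>S. s / m \<in> A"
  using assms
proof (induction S rule: finite_ne_induct)
  case (singleton x)
  then show ?case by (auto intro: one_mem)
next
  case (insert x F)
  then obtain m where m: "m \<in> F" "\<forall>s\<in>F. s / m \<in> A" by auto
  have nz: "m \<noteq> 0" "x \<noteq> 0" using insert m by auto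
  show ?case
  proof (cases "x / m \<in> A")
    case True
    then show ?thesis using m by auto
  next
    case False
    then have mx: "m / x \<in> A"
      using inverse_mem_cases[of "x / m"] by simp
    have "s / x \<in> A" if "s \<in> F" for s
      using mult_mem[OF _ mx, of "s / m"] m that nz by simp
    then show ?thesis using nz one_mem by auto
  qed
qed

text \<open>\<open>k\<close> is the first index where the valuation of the coefficients is least, so
  all earlier coefficients have strictly larger valuation.\<close>

lemma ex_first_dominating_coeff:
  assumes "f \<noteq> 0"
  obtains k where "coeff f k \<noteq> 0" "\<And>i. coeff f i / coeff f k \<in> A"
    "\<And>i. i < k \<Longrightarrow> coeff f i / coeff f k \<in> nonunits"
proof -
  define P where "P k \<longleftrightarrow> coeff f k \<noteq> 0 \<and> (\<forall>i. coeff f i / coeff f k \<in> A)" for k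
  define S where "S = set (coeffs f) - {0}"
  have "lead_coeff f \<in> S"
    using assms coeff_in_coeffs[OF assms, of "degree f"] by (simp add: S_def)
  then have "finite S" "S \<noteq> {}" "0 \<notin> S"
    unfolding S_def by auto
  then obtain m where m: "m \<in> S" "\<forall>s\<in>S. s / m \<in> A"
    using ex_dominating by blast
  have mem: "coeff f i \<in> S \<or> coeff f i = 0" for i
    using coeff_in_coeffs[OF assms, of i] coeff_eq_0[of f i] by (force simp: S_def not_le[symmetric])
  obtain k0 where k0: "coeff f k0 = m"
    using m(1) by (auto simp: S_def coeffs_def split: if_splits)
  have "coeff f i / m \<in> A" for i
    using mem[of i] m(2) zero_mem by auto
  then have "P k0"
    using m(1) \<open>0 \<notin> S\<close> by (auto simp: P_def k0)
  define k where "k = (LEAST k. P k)"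
  have k: "P k"
    unfolding k_def using \<open>P k0\<close> by (rule LeastI)
  have least: "\<not> P i" if "i < k" for i
    using that unfolding k_def by (rule not_less_Least)
  have "coeff f i / coeff f k \<in> nonunits" if "i < k" for i
  proof (rule ccontr)
    \<comment> \<open>Then the coefficients at \<open>i\<close> and \<open>k\<close> have the same
      valuation, and \<open>i\<close> is a smaller index with property \<open>P\<close>.\<close>
    assume "coeff f i / coeff f k \<notin> nonunits"
    then have nz: "coeff f i \<noteq> 0" and inv: "coeff f k / coeff f i \<in> A"
      using k zero_mem by (auto simp: nonunits_def P_def)
    have "coeff f j / coeff f i \<in> A" for j
    proof -
      have "coeff f j / coeff f i = coeff f j / coeff f k * (coeff f k / coeff f i)"
        using k by (simp add: P_def)
      then show ?thesis
        using k inv mult_mem by (auto simp: P_def simp del: times_divide_eq_right times_divide_eq_left)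
    qed
    then show False
      using nz least[OF that] by (auto simp: P_def)
  qed
  then show thesis
    using k that[of k] by (auto simp: P_def)
qed

text \<open>Let \<open>k\<close> and \<open>l\<close> be the first indices of least valuation in
  \<open>f\<close> and \<open>g\<close>. In coefficient \<open>k + l\<close> of the product the term
  \<open>c\<close> from \<open>k\<close> and \<open>l\<close> has strictly smaller valuation than
  all others, so it equals that coefficient up to a unit and lies in \<open>A\<close>. Every product
  of a coefficient of \<open>f\<close> with one of \<open>g\<close> is an \<open>A\<close>-multiple
  of \<open>c\<close>.\<close>

lemma coeff_products_mem:
  assumes fg: "\<And>n. coeff (f * g) n \<in> A"
  shows "coeff f i * coeff g j \<in> A"
proof (cases "f = 0 \<or> g = 0")
  case True
  then show ?thesis by (auto simp: zero_mem)
next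
  case False
  obtain k where k: "coeff f k \<noteq> 0" "\<And>i. coeff f i / coeff f k \<in> A"
    "\<And>i. i < k \<Longrightarrow> coeff f i / coeff f k \<in> nonunits"
    using ex_first_dominating_coeff[of f] False by blast
  obtain l where l: "coeff g l \<noteq> 0" "\<And>i. coeff g i / coeff g l \<in> A"
    "\<And>i. i < l \<Longrightarrow> coeff g i / coeff g l \<in> nonunits"
    using ex_first_dominating_coeff[of g] False by blast
  define c where "c = coeff f k * coeff g l"
  define r where "r i = coeff f i / coeff f k * (coeff g (k + l - i) / coeff g l)" for i
  \<comment> \<open>An index pair with sum \<open>k + l\<close> other than \<open>(k, l)\<close> has
    its first entry below \<open>k\<close> or its second below \<open>l\<close>.\<close>
  have r: "r i \<in> nonunits" if "i \<in> {..k + l} - {k}" for i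
  proof (cases "i < k")
    case True
    then show ?thesis
      using mult_nonunit[OF l(2) k(3), of i "k + l - i"] by (simp add: r_def mult.commute)
  next
    case False
    then have "k + l - i < l" using that by auto
    then show ?thesis
      using mult_nonunit[OF k(2) l(3)] by (simp add: r_def)
  qed
  have "coeff (f * g) (k + l) = (\<Sum>i\<le>k + l. c * r i)"
    unfolding coeff_mult by (rule sum.cong) (auto simp: c_def r_def k l)
  also have "\<dots> = c * (\<Sum>i\<le>k + l. r i)"
    by (simp add: sum_distrib_left)
  also have "(\<Sum>i\<le>k + l. r i) = 1 + sum r ({..k + l} - {k})"
    by (subst sum.remove[of _ k]) (auto simp: r_def k l)
  finally have eq: "coeff (f * g) (k + l) = c * (1 + sum r ({..k + l} - {k}))" .
  note unit = inverse_one_plus_nonunit[OF sum_nonunit[of "{..k + l} - {k}" r, OF r]]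
  have "c = coeff (f * g) (k + l) * inverse (1 + sum r ({..k + l} - {k}))"
    using unit(1) eq by simp
  then have "c \<in> A"
    using mult_mem[OF fg unit(2)] by simp
  moreover have "coeff f i * coeff g j = c * (coeff f i / coeff f k * (coeff g j / coeff g l))"
    using k l by (simp add: c_def)
  ultimately show ?thesis
    using mult_mem[OF _ mult_mem[OF k(2) l(2)]] by metis
qed

end

text \<open>
  Such a ring is a valuation ring: if \<open>t\<close> and \<open>1/t\<close> were both missing, maximality would put \<open>1/y\<close>
  into \<open>A[t]\<close> and \<open>A[1/t]\<close>, and the two resulting relations with coefficients in \<open>yA\<close> could be
  used to lower each other's degree forever.
\<close>

locale maximal_subring_avoiding_inverse = field_subring +
  fixes y
  assumes y_mem: "y \<in> A" and y_nz: "y \<noteq> 0" and inverse_notin: "inverse y \<notin> A"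
    and maximal: "\<And>B. field_subring B \<Longrightarrow> A \<subseteq> B \<Longrightarrow> inverse y \<notin> B \<Longrightarrow> B = A"
begin

definition multiples :: "'a set" where
  "multiples = (*) y ` A"

lemma inverse_mem_adjoin:
  assumes "t \<notin> A"
  shows "inverse y \<in> adjoin t"
  using maximal[OF field_subring_adjoin subset_adjoin] mem_adjoin_self assms by metis

lemma multiples_subset: "multiples \<subseteq> A"
  by (auto simp: multiples_def intro: mult_mem y_mem)

lemma zero_multiple: "0 \<in> multiples"
  unfolding multiples_def using zero_mem by force

lemma diff_multiple:
  assumes "a \<in> multiples" "b \<in> multiples"
  shows "a - b \<in> multiples"
proof -
  obtain c d where "c \<in> A" "d \<in> A" "a = y * c" "b = y * d"
    using assms by (auto simp: multiples_def)
  then show ?thesis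
    unfolding multiples_def by (auto simp: right_diff_distrib intro!: image_eqI[of _ _ "c - d"] diff_mem)
qed

lemma mult_multiple: "a \<in> A \<Longrightarrow> b \<in> multiples \<Longrightarrow> a * b \<in> multiples"
  unfolding multiples_def by (auto simp: mult.left_commute[of a] intro: mult_mem)

lemma add_multiple:
  assumes "a \<in> multiples" "b \<in> multiples"
  shows "a + b \<in> multiples"
proof -
  obtain c d where "c \<in> A" "d \<in> A" "a = y * c" "b = y * d"
    using assms by (auto simp: multiples_def)
  then show ?thesis
    unfolding multiples_def by (auto simp: distrib_left intro!: image_eqI[of _ _ "c + d"] add_mem)
qed

lemma one_notin_multiples: "1 \<notin> multiples"
proof
  assume "1 \<in> multiples"
  then obtain b where "b \<in> A" "1 = y * b" by (auto simp: multiples_def)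
  then show False using inverse_notin by (metis inverse_unique)
qed

lemma one_minus_power_multiple:
  assumes "m \<in> multiples"
  shows "1 - (1 - m) ^ n \<in> multiples"
proof (induction n)
  case 0
  show ?case by (simp add: zero_multiple)
next
  case (Suc n)
  have A: "(1 - m) ^ n \<in> A"
    using assms multiples_subset by (auto intro!: power_mem diff_mem one_mem)
  have "1 - (1 - m) ^ Suc n = (1 - (1 - m) ^ n) + (1 - m) ^ n * m"
    by (simp add: algebra_simps)
  then show ?case
    using add_multiple[OF Suc mult_multiple[OF A assms]] by (simp only:)
qed

text \<open>\<open>yA\<close> lies in the Jacobson radical: if \<open>1/(1 - m)\<close> were
  missing, \<open>1/y\<close> would be a polynomial in it of some degree \<open>n\<close>, so
  \<open>(1 - m)^n / y\<close> would lie in \<open>A\<close>. As \<open>(1 - m)^n\<close> differs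
  from \<open>1\<close> by a multiple of \<open>y\<close>, \<open>1/y\<close> would lie in
  \<open>A\<close> as well.\<close>

lemma inverse_one_minus_multiple:
  assumes m: "m \<in> multiples"
  shows "1 - m \<noteq> 0" "inverse (1 - m) \<in> A"
proof -
  show nz: "1 - m \<noteq> 0"
    using m one_notin_multiples by auto
  show "inverse (1 - m) \<in> A"
  proof (rule ccontr)
    assume "inverse (1 - m) \<notin> A"
    then obtain p where p: "inverse y = poly p (inverse (1 - m))" "\<forall>i. coeff p i \<in> A"
      using inverse_mem_adjoin by (force simp: adjoin_def)
    define n where "n = degree p"
    have A: "1 - m \<in> A"
      using m multiples_subset by (auto intro: diff_mem one_mem)
    have "(1 - m) ^ n * inverse y = poly (reflect_poly p) (1 - m)"
      using p(1) nz by (simp add: poly_reflect_poly_nz n_def)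
    moreover have "poly (reflect_poly p) (1 - m) \<in> A"
      using p(2) A zero_mem by (auto intro!: poly_mem simp: coeff_reflect_poly)
    moreover obtain b where b: "b \<in> A" "1 - (1 - m) ^ n = y * b"
      using one_minus_power_multiple[OF m] by (auto simp: multiples_def)
    moreover have "inverse y = (1 - m) ^ n * inverse y + b"
    proof -
      have "(1 - m) ^ n = 1 - y * b" using b(2) by (simp add: algebra_simps)
      then show ?thesis using y_nz by (simp add: field_simps)
    qed
    ultimately show False
      using inverse_notin add_mem by metis
  qed
qed

text \<open>Splitting off the constant term \<open>c\<close> of \<open>Q\<close>, dividing by the
  unit \<open>1 - c\<close> and multiplying by a power of \<open>t\<close> turns the relation for
  \<open>1/t\<close> into \<open>t^k = Qr(t)\<close>, where \<open>Qr\<close> has degree below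
  \<open>k\<close> and coefficients in \<open>yA\<close>. This replaces the leading term of
  \<open>P\<close>.\<close>

lemma lower_degree_relation:
  assumes P: "\<And>i. coeff P i \<in> multiples" "poly P t = 1"
    and Q: "\<And>i. coeff Q i \<in> multiples" "poly Q (inverse t) = 1"
    and deg: "degree Q \<le> degree P" and t: "t \<noteq> 0"
  obtains P' where "\<And>i. coeff P' i \<in> multiples" "poly P' t = 1" "degree P' < degree P"
proof -
  define n k where "n = degree P" and "k = degree Q"
  obtain c Q1 where Q1: "Q = pCons c Q1"
    by (cases Q) auto
  have c: "c \<in> multiples"
    using Q(1)[of 0] Q1 by simp
  define u where "u = 1 - c"
  have u: "u \<noteq> 0" "inverse u \<in> A"
    using inverse_one_minus_multiple[OF c] by (auto simp: u_def)
  have Q1t: "poly Q1 (inverse t) = t * u"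
    using Q(2) t Q1 by (simp add: u_def field_simps)
  then have Q1nz: "Q1 \<noteq> 0"
    using t u by auto
  have k: "k = Suc (degree Q1)"
    using Q1 Q1nz by (simp add: k_def)
  define Qr where "Qr = smult (inverse u) (reflect_poly Q1)"
  have Q1c: "coeff Q1 i \<in> multiples" for i
    using Q(1)[of "Suc i"] Q1 by simp
  have Qr_coeff: "coeff Qr i \<in> multiples" for i
    using Q1c zero_multiple u by (auto simp: Qr_def coeff_reflect_poly intro: mult_multiple)
  have Qr_deg: "degree Qr < k"
    using degree_reflect_poly_le[of Q1] u by (simp add: Qr_def k)
  have Qr_t: "poly Qr t = t ^ k"
    using t u Q1t by (simp add: Qr_def poly_reflect_poly_nz k)
  define a where "a = lead_coeff P"
  have a: "a \<in> A"
    using P(1) multiples_subset by (auto simp: a_def)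
  define P' where "P' = P - monom a n + smult a (monom 1 (n - k) * Qr)"
  have nk: "k \<le> n" using deg by (simp add: n_def k_def)
  have "coeff P' i \<in> multiples" for i
  proof -
    have "coeff (P - monom a n) i \<in> multiples"
      using P(1) zero_multiple by (auto simp: a_def n_def)
    moreover have "coeff (smult a (monom 1 (n - k) * Qr)) i \<in> multiples"
      using a Qr_coeff zero_multiple by (auto simp: coeff_monom_mult intro: mult_multiple)
    ultimately show ?thesis
      unfolding P'_def coeff_add by (rule add_multiple)
  qed
  moreover have "poly P' t = 1"
    using P(2) nk by (simp add: P'_def poly_monom Qr_t flip: power_add)
  \<comment> \<open>Since \<open>k\<close> is a successor and \<open>k \<le> n\<close>, the bound
    \<open>n - 1\<close> is strictly below \<open>n\<close>.\<close>
  moreover have "degree P' \<le> n - 1"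
  proof (rule degree_le, intro allI impI)
    fix i assume "n - 1 < i"
    then have i: "n \<le> i" by simp
    have "coeff (P - monom a n) i = 0"
      using i by (cases "i = n") (auto simp: a_def n_def coeff_eq_0)
    moreover have "coeff Qr (i - (n - k)) = 0"
      using i nk Qr_deg by (intro coeff_eq_0) auto
    ultimately show "coeff P' i = 0"
      by (auto simp: P'_def coeff_monom_mult)
  qed
  ultimately show thesis
    using that[of P'] nk k by (simp add: n_def)
qed

text \<open>Infinite descent on the sum of the degrees; exchanging \<open>t\<close> and
  \<open>1/t\<close> allows the relation of larger degree to be lowered in either case.\<close>

lemma no_opposite_relations:
  assumes "\<And>i. coeff P i \<in> multiples" "poly P t = 1"
    and "\<And>i. coeff Q i \<in> multiples" "poly Q (inverse t) = 1" and "t \<noteq> 0"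
  shows False
  using assms
proof (induction "degree P + degree Q" arbitrary: P Q rule: less_induct)
  case less
  show False
  proof (cases "degree Q \<le> degree P")
    case True
    obtain P' where "\<And>i. coeff P' i \<in> multiples" "poly P' t = 1" "degree P' < degree P"
      using lower_degree_relation[OF less.prems(1,2,3,4) True less.prems(5)] by blast
    then show False
      using less.hyps[of P' Q] less.prems by auto
  next
    case False
    then have "degree P \<le> degree Q" by simp
    then obtain Q' where "\<And>i. coeff Q' i \<in> multiples" "poly Q' (inverse t) = 1"
      "degree Q' < degree Q"
      using lower_degree_relation[of Q "inverse t" P] less.prems by auto
    then show False
      using less.hyps[of P Q'] less.prems by auto
  qed
qed

lemma relation_of_notin:
  assumes "t \<notin> A"
  obtains P where "\<And>i. coeff P i \<in> multiples" "poly P t = 1"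
proof -
  obtain p where p: "inverse y = poly p t" "\<forall>i. coeff p i \<in> A"
    using inverse_mem_adjoin[OF assms] by (auto simp: adjoin_def)
  show thesis
  proof (rule that)
    show "coeff (smult y p) i \<in> multiples" for i
      using p(2) by (auto simp: multiples_def)
    show "poly (smult y p) t = 1"
      using p(1)[symmetric] y_nz by simp
  qed
qed

sublocale valuation_subring A
proof
  fix t
  show "t \<in> A \<or> inverse t \<in> A"
  proof (rule ccontr)
    assume *: "\<not> (t \<in> A \<or> inverse t \<in> A)"
    then have "t \<noteq> 0" using zero_mem by auto
    moreover obtain P where "\<And>i. coeff P i \<in> multiples" "poly P t = 1"
      using relation_of_notin[of t] * by auto
    moreover obtain Q where "\<And>i. coeff Q i \<in> multiples" "poly Q (inverse t) = 1"
      using relation_of_notin[of "inverse t"] * by auto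
    ultimately show False by (rule no_opposite_relations[rotated -1])
  qed
qed

end

section \<open>Existence of valuation rings by Zorn's lemma\<close>

lemma field_subring_Union_chain:
  assumes "\<And>B. B \<in> C \<Longrightarrow> field_subring B" "C \<noteq> {}"
    and chain: "\<And>B B'. B \<in> C \<Longrightarrow> B' \<in> C \<Longrightarrow> B \<subseteq> B' \<or> B' \<subseteq> B"
  shows "field_subring (\<Union>C)"
proof
  show "1 \<in> \<Union>C"
    using assms field_subring.one_mem by blast
next
  fix a b assume "a \<in> \<Union>C" "b \<in> \<Union>C"
  then obtain B where "B \<in> C" "a \<in> B" "b \<in> B"
    using chain by blast
  then show "a - b \<in> \<Union>C" "a * b \<in> \<Union>C"
    using field_subring.diff_mem[of B a b] field_subring.mult_mem[of B a b] assms(1)[of B] by auto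
qed

text \<open>Among the subrings that contain \<open>R\<close> and miss \<open>1/y\<close>, Zorn's
  lemma gives a maximal one, which is a valuation ring.\<close>

lemma ex_valuation_subring_avoiding:
  assumes R: "field_subring R" and y: "y \<in> R" "y \<noteq> 0" "inverse y \<notin> R"
  obtains V where "valuation_subring V" "R \<subseteq> V" "inverse y \<notin> V"
proof -
  define F where "F = {B. field_subring B \<and> R \<subseteq> B \<and> inverse y \<notin> B}"
  have "\<exists>M\<in>F. \<forall>X\<in>F. M \<subseteq> X \<longrightarrow> X = M"
  proof (rule subset_Zorn_nonempty)
    show "F \<noteq> {}" using R y by (auto simp: F_def)
  next
    fix C assume C: "C \<noteq> {}" "subset.chain F C"
    then have "field_subring (\<Union>C)"
      by (intro field_subring_Union_chain) (auto simp: subset.chain_def F_def)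
    then show "\<Union>C \<in> F"
      using C by (auto simp: subset.chain_def F_def)
  qed
  then obtain V where V: "V \<in> F" and max: "\<forall>X\<in>F. V \<subseteq> X \<longrightarrow> X = V" by blast
  interpret field_subring V using V by (simp add: F_def)
  interpret maximal_subring_avoiding_inverse V y
  proof
    show "y \<in> V" "y \<noteq> 0" "inverse y \<notin> V" using V y by (auto simp: F_def)
    show "B = V" if "field_subring B" "V \<subseteq> B" "inverse y \<notin> B" for B
      using max V that by (auto simp: F_def)
  qed
  show thesis
    using that[of V] V valuation_subring_axioms by (auto simp: F_def)
qed

section \<open>Content of products over an integrally closed domain\<close>

lemma fract_poly_reflect_poly: "fract_poly (reflect_poly p) = reflect_poly (fract_poly p)"
proof (rule poly_eqI)
  fix n
  have "degree (fract_poly p) = degree p" by (rule degree_map_poly) simp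
  then show "coeff (fract_poly (reflect_poly p)) n = coeff (reflect_poly (fract_poly p)) n"
    by (simp add: coeff_map_poly coeff_reflect_poly)
qed

text \<open>An integrally closed domain is the intersection of the valuation rings containing it.
  The subring generated by the domain and \<open>1/x\<close> misses \<open>x\<close>, since
  otherwise \<open>x\<close> would be integral; a valuation ring above it still misses
  \<open>x\<close>.\<close>

lemma ex_valuation_subring_of_integrally_closed:
  assumes ic: "integrally_closed_domain TYPE('a::idom)"
    and x: "(x :: 'a fract) \<notin> range to_fract"
  obtains V where "valuation_subring V" "range to_fract \<subseteq> V" "x \<notin> V"
proof -
  have xnz: "x \<noteq> 0" using x by (metis rangeI to_fract_0)
  define y where "y = inverse x"
  define R where "R = range (\<lambda>p :: 'a poly. poly (fract_poly p) y)"
  have "field_subring R"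
  proof
    show "1 \<in> R" unfolding R_def by (rule range_eqI[of _ _ 1]) simp
    fix a b assume "a \<in> R" "b \<in> R"
    then obtain p q :: "'a poly" where "a = poly (fract_poly p) y" "b = poly (fract_poly q) y"
      by (auto simp: R_def)
    then show "a - b \<in> R" "a * b \<in> R"
      unfolding R_def
      by (auto intro: range_eqI[of _ _ "p - q"] range_eqI[of _ _ "p * q"])
  qed
  moreover have "y \<in> R"
    unfolding R_def by (rule range_eqI[of _ _ "[:0, 1:]"]) (simp add: map_poly_pCons)
  moreover have "y \<noteq> 0" using xnz by (simp add: y_def)
  moreover have "inverse y \<notin> R"
  proof
    assume "inverse y \<in> R"
    then obtain p :: "'a poly" where p: "x = poly (fract_poly p) (inverse x)"
      by (auto simp: R_def y_def)
    define n where "n = degree p"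
    \<comment> \<open>The equation \<open>x = p(1/x)\<close> times \<open>x^n\<close>. The reflected
      polynomial has degree at most \<open>n\<close>, so \<open>m\<close> is monic.\<close>
    define m where "m = monom 1 (Suc n) - reflect_poly p"
    have "degree (reflect_poly p) < Suc n"
      using degree_reflect_poly_le[of p] by (simp add: n_def)
    then have "coeff (reflect_poly p) (Suc n) = 0" "degree m \<le> Suc n"
      by (auto simp: m_def coeff_eq_0 intro!: degree_diff_le degree_monom_le)
    then have "lead_coeff m = 1"
      by (metis (no_types) coeff_diff coeff_monom diff_zero le_antisym le_degree m_def zero_neq_one)
    moreover have "poly (fract_poly m) x = x ^ Suc n - x ^ n * poly (fract_poly p) (inverse x)"
      using xnz
      by (simp add: m_def fract_poly_reflect_poly poly_reflect_poly_nz map_poly_monom poly_monom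
          degree_map_poly n_def)
    then have "poly (fract_poly m) x = 0"
      using p by simp
    ultimately show False
      using ic x unfolding integrally_closed_domain_def integral_over_domain_def by blast
  qed
  ultimately obtain V where V: "valuation_subring V" "R \<subseteq> V" "inverse y \<notin> V"
    by (rule ex_valuation_subring_avoiding)
  have "to_fract r \<in> R" for r
    unfolding R_def by (rule range_eqI[of _ _ "[:r:]"]) (simp add: map_poly_pCons)
  then show thesis
    using that[of V] V by (auto simp: y_def)
qed

lemma const_dvd_coeff_products:
  fixes p q :: "'a::idom poly"
  assumes ic: "integrally_closed_domain TYPE('a)" and c: "c \<noteq> 0" and dvd: "[:c:] dvd p * q"
  shows "c dvd coeff p i * coeff q j"
proof -
  define x where "x = to_fract (coeff p i * coeff q j) / to_fract c"
  have "x \<in> range to_fract"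
  proof (rule ccontr)
    assume "x \<notin> range to_fract"
    then obtain V where V: "valuation_subring V" "range to_fract \<subseteq> V" "x \<notin> V"
      using ex_valuation_subring_of_integrally_closed[OF ic] by blast
    interpret valuation_subring V by fact
    obtain r where r: "p * q = [:c:] * r" using dvd by blast
    \<comment> \<open>Dividing the factor \<open>q\<close> by \<open>c\<close> turns the product
      into \<open>r\<close>, so Gauss' lemma in \<open>V\<close> applies to \<open>p\<close> and
      \<open>q / c\<close>.\<close>
    have "fract_poly p * smult (inverse (to_fract c)) (fract_poly q)
        = smult (inverse (to_fract c)) (fract_poly (p * q))"
      by simp
    also have "\<dots> = fract_poly r"
      using c by (simp only: r fract_poly_mult) (simp add: map_poly_pCons)
    finally have "coeff (fract_poly p * smult (inverse (to_fract c)) (fract_poly q)) n \<in> V" for n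
      using V by (auto simp: coeff_map_poly)
    from coeff_products_mem[OF this, of i j] have "x \<in> V"
      by (simp add: coeff_map_poly x_def divide_inverse mult_ac)
    with V show False by simp
  qed
  then obtain d where "x = to_fract d" by blast
  then have "to_fract (coeff p i * coeff q j) = to_fract (c * d)"
    using c by (simp add: x_def field_simps)
  then show ?thesis
    by (simp only: to_fract_eq_iff) simp
qed

section \<open>Dual compactness\<close>

text \<open>
  Scaling a nonzero element of \<open>\<Inter>a\<in>A. aD\<close> to \<open>1\<close> turns each \<open>a\<close> into some \<open>1/s\<close> with
  \<open>s\<close> in \<open>D\<close>, and then \<open>a/b\<close> lies in the intersection iff \<open>b\<close> divides every \<open>a * s\<close>.
\<close>

definition same_dual :: "'a::idom set \<Rightarrow> 'a set \<Rightarrow> bool" where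
  "same_dual S F \<longleftrightarrow>
     (\<forall>a b. b \<noteq> 0 \<longrightarrow> (\<forall>s\<in>S. b dvd a * s) \<longleftrightarrow> (\<forall>h\<in>F. b dvd a * h))"

lemma same_dualD:
  "same_dual S F \<Longrightarrow> b \<noteq> 0 \<Longrightarrow> (\<forall>s\<in>S. b dvd a * s) \<longleftrightarrow> (\<forall>h\<in>F. b dvd a * h)"
  by (auto simp: same_dual_def)

lemma ball_dvd_mult_Diff_0:
  fixes a b :: "'a::idom"
  shows "(\<forall>s\<in>S - {0}. b dvd a * s) \<longleftrightarrow> (\<forall>s\<in>S. b dvd a * s)"
proof -
  have "b dvd a * s" if "s \<in> S" "\<forall>s\<in>S - {0}. b dvd a * s" for s
    using that by (cases "s = 0") auto
  then show ?thesis by blast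
qed

lemma mem_principal_fractional_ideal_scaled:
  assumes "y \<noteq> 0" "h \<noteq> 0" "b \<noteq> (0 :: 'a::idom)"
  shows "y * (to_fract a / to_fract b) \<in> principal_fractional_ideal (y / to_fract h)
           \<longleftrightarrow> b dvd a * h"
proof -
  have "y * (to_fract a / to_fract b) = y / to_fract h * to_fract d \<longleftrightarrow> a * h = b * d" for d
  proof -
    have "y * (to_fract a / to_fract b) = y / to_fract h * to_fract d
        \<longleftrightarrow> to_fract a * to_fract h = to_fract b * to_fract d"
      using assms by (simp add: field_simps)
    then show ?thesis by (simp only: to_fract_mult[symmetric] to_fract_eq_iff)
  qed
  then show ?thesis
    by (auto simp: principal_fractional_ideal_def dvd_def)
qed

text \<open>As \<open>y\<close> is nonzero, every element of the quotient field has the form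
  \<open>y * (a / b)\<close>, and its membership is a family of divisibilities.\<close>

lemma Inter_principal_fractional_ideal_scaled_eq_iff:
  assumes y: "y \<noteq> 0" and "0 \<notin> S" "0 \<notin> F"
  shows "(\<Inter>s\<in>S. principal_fractional_ideal (y / to_fract s)) =
           (\<Inter>h\<in>F. principal_fractional_ideal (y / to_fract h)) \<longleftrightarrow> same_dual S F"
    (is "?I S = ?I F \<longleftrightarrow> _")
proof -
  have mem: "y * (to_fract a / to_fract b) \<in> ?I T \<longleftrightarrow> (\<forall>t\<in>T. b dvd a * t)"
    if "b \<noteq> 0" "0 \<notin> T" for a b and T :: "'a set"
    unfolding INT_iff using that
    by (intro ball_cong refl mem_principal_fractional_ideal_scaled[OF y]) auto
  have "same_dual S F \<longleftrightarrow> (\<forall>a b. b \<noteq> 0 \<longrightarrow>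
      (y * (to_fract a / to_fract b) \<in> ?I S \<longleftrightarrow> y * (to_fract a / to_fract b) \<in> ?I F))"
    unfolding same_dual_def
    by (simp only: mem[OF _ assms(2)] mem[OF _ assms(3)] not_False_eq_True cong: imp_cong)
  also have "\<dots> \<longleftrightarrow> (\<forall>z. z \<in> ?I S \<longleftrightarrow> z \<in> ?I F)"
  proof (rule iffI, rule allI)
    fix z
    assume *: "\<forall>a b. b \<noteq> 0 \<longrightarrow>
      (y * (to_fract a / to_fract b) \<in> ?I S \<longleftrightarrow> y * (to_fract a / to_fract b) \<in> ?I F)"
    obtain a b where "z / y = Fract a b" "b \<noteq> 0"
      by (cases "z / y" rule: Fract_cases) (rule that)
    then have "z = y * (to_fract a / to_fract b)" "b \<noteq> 0"
      using y by (auto simp: Fract_conv_to_fract field_simps)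
    then show "z \<in> ?I S \<longleftrightarrow> z \<in> ?I F"
      using * by blast
  qed blast
  finally show ?thesis by blast
qed

lemma ex_scaled_set:
  assumes "y \<noteq> 0" and y: "y \<in> (\<Inter>a\<in>A. principal_fractional_ideal a)"
  obtains S where "0 \<notin> S" "A = (\<lambda>s. y / to_fract s) ` S"
proof
  define S where "S = {s. s \<noteq> 0 \<and> y / to_fract s \<in> A}"
  show "0 \<notin> S" by (simp add: S_def)
  have "\<exists>s\<in>S. a = y / to_fract s" if a: "a \<in> A" for a
  proof -
    obtain s where s: "y = a * to_fract s"
      using y a by (auto simp: principal_fractional_ideal_def)
    then have "s \<noteq> 0" "a = y / to_fract s"
      using assms(1) by (auto simp: field_simps)
    then show ?thesis using a by (auto simp: S_def)
  qed
  then show "A = (\<lambda>s. y / to_fract s) ` S"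
    by (auto simp: S_def)
qed

lemma dually_compact_iff:
  "dually_compact TYPE('a::idom) \<longleftrightarrow> (\<forall>S :: 'a set. \<exists>F. finite F \<and> same_dual S F)"
proof
  assume dc: "dually_compact TYPE('a)"
  show "\<forall>S :: 'a set. \<exists>F. finite F \<and> same_dual S F"
  proof
    fix S :: "'a set"
    show "\<exists>F. finite F \<and> same_dual S F"
    proof (cases "S \<subseteq> {0}")
      case True
      then show ?thesis by (intro exI[of _ "{}"]) (auto simp: same_dual_def)
    next
      case False
      define T where "T = S - {0}"
      define A where "A = (\<lambda>s. 1 / to_fract s) ` T"
      have T: "0 \<notin> T" "T \<noteq> {}" using False by (auto simp: T_def)
      have one: "1 \<in> (\<Inter>a\<in>A. principal_fractional_ideal a)"
      proof -
        have "1 \<in> principal_fractional_ideal (1 / to_fract t)" if "t \<in> T" for t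
          using mem_principal_fractional_ideal_scaled[of "1 :: 'a fract" t 1 1] that T(1)
          by (cases "t = 0") auto
        then show ?thesis by (auto simp: A_def)
      qed
      have "A \<noteq> {}" "A \<subseteq> UNIV - {0}"
        using T by (auto simp: A_def)
      moreover have "(\<Inter>a\<in>A. principal_fractional_ideal a) \<noteq> {0}"
        using one by (metis singletonD zero_neq_one)
      ultimately have "A \<noteq> {} \<and> A \<subseteq> UNIV - {0} \<and> (\<Inter>a\<in>A. principal_fractional_ideal a) \<noteq> {0}"
        by (intro conjI)
      from dc[unfolded dually_compact_def, rule_format, OF this]
      obtain B where B: "finite B" "B \<noteq> {}" "B \<subseteq> UNIV - {0}"
        "(\<Inter>a\<in>A. principal_fractional_ideal a) = (\<Inter>x\<in>B. principal_fractional_ideal x)"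
        by (elim exE conjE) (rule that)
      \<comment> \<open>The intersection over \<open>B\<close> also contains \<open>1\<close>, so
        every element of \<open>B\<close> is the inverse of an element of the domain.\<close>
      obtain F where F: "0 \<notin> F" "B = (\<lambda>h. 1 / to_fract h) ` F"
      proof (rule ex_scaled_set)
        show "1 \<in> (\<Inter>x\<in>B. principal_fractional_ideal x)"
          using one by (simp only: B(4))
      qed simp
      have "finite F"
        using B(1) F by (auto simp: inj_on_def dest!: finite_imageD)
      moreover have "same_dual T F"
        using Inter_principal_fractional_ideal_scaled_eq_iff[of 1 T F] T F B(4)
        by (simp add: A_def)
      then have "same_dual S F"
        by (simp add: same_dual_def T_def ball_dvd_mult_Diff_0)
      ultimately show ?thesis by blast
    qed
  qed
next
  assume *: "\<forall>S :: 'a set. \<exists>F. finite F \<and> same_dual S F"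
  show "dually_compact TYPE('a)"
    unfolding dually_compact_def
  proof (intro allI impI)
    fix A :: "'a fract set"
    assume A: "A \<noteq> {} \<and> A \<subseteq> UNIV - {0} \<and> (\<Inter>a\<in>A. principal_fractional_ideal a) \<noteq> {0}"
    have "0 \<in> principal_fractional_ideal a" for a :: "'a fract"
      unfolding principal_fractional_ideal_def by (auto intro!: exI[of _ 0])
    then have "{0} \<subseteq> (\<Inter>a\<in>A. principal_fractional_ideal a)"
      by simp
    with A have "\<not> (\<Inter>a\<in>A. principal_fractional_ideal a) \<subseteq> {0}"
      by (metis subset_antisym)
    then obtain y where y: "y \<noteq> 0" "y \<in> (\<Inter>a\<in>A. principal_fractional_ideal a)"
      by blast
    obtain S where S: "0 \<notin> S" "A = (\<lambda>s. y / to_fract s) ` S"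
      using ex_scaled_set[OF y] by blast
    obtain F where F: "finite F" "same_dual S F" using * by blast
    obtain s where s: "s \<in> S" using A S by auto
    \<comment> \<open>Dropping \<open>0\<close> keeps the generators nonzero; adding an element of
      \<open>S\<close> keeps the set nonempty and imposes only a condition that \<open>S\<close>
      already imposes.\<close>
    define G where "G = insert s (F - {0})"
    have "same_dual S G"
      using F(2) s by (auto simp: same_dual_def G_def ball_dvd_mult_Diff_0)
    moreover have "finite G" "G \<noteq> {}" "0 \<notin> G"
      using F s S by (auto simp: G_def)
    ultimately show "\<exists>B. finite B \<and> B \<noteq> {} \<and> B \<subseteq> UNIV - {0} \<and>
        (\<Inter>a\<in>A. principal_fractional_ideal a) = (\<Inter>x\<in>B. principal_fractional_ideal x)"
      using Inter_principal_fractional_ideal_scaled_eq_iff[OF y(1) S(1), of G] y(1)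
      by (intro exI[of _ "(\<lambda>h. y / to_fract h) ` G"]) (auto simp: S(2) image_image)
  qed
qed

section \<open>Descent from \<open>R[X]\<close> to \<open>R\<close>\<close>

text \<open>A constant divides a polynomial iff it divides every coefficient, so for constant
  \<open>a\<close> and \<open>b\<close> a finite set of polynomials tests the same as the finite set
  of its coefficients.\<close>

lemma dually_compact_of_poly:
  assumes "dually_compact TYPE('a::idom poly)"
  shows "dually_compact TYPE('a)"
  unfolding dually_compact_iff
proof
  fix S :: "'a set"
  obtain F where F: "finite F" "same_dual ((\<lambda>s. [:s:]) ` S) F"
    using assms unfolding dually_compact_iff by blast
  define G where "G = (\<Union>h\<in>F. set (coeffs h))"
  have dvd_iff: "[:b:] dvd smult a h \<longleftrightarrow> (\<forall>c\<in>set (coeffs h). b dvd a * c)" for a b and h :: "'a poly"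
    by (auto simp: const_poly_dvd_iff forall_coeffs_conv[where P = "\<lambda>c. b dvd a * c"])
  have "same_dual S G"
    unfolding same_dual_def
  proof (intro allI impI)
    fix a b :: 'a assume "b \<noteq> 0"
    then have "(\<forall>f\<in>(\<lambda>s. [:s:]) ` S. [:b:] dvd [:a:] * f) \<longleftrightarrow> (\<forall>h\<in>F. [:b:] dvd [:a:] * h)"
      by (intro same_dualD[OF F(2)]) simp
    moreover have "(\<forall>f\<in>(\<lambda>s. [:s:]) ` S. [:b:] dvd [:a:] * f) \<longleftrightarrow> (\<forall>s\<in>S. b dvd a * s)"
      by (auto simp: mult.commute)
    moreover have "(\<forall>h\<in>F. [:b:] dvd [:a:] * h) \<longleftrightarrow> (\<forall>c\<in>G. b dvd a * c)"
      by (simp add: G_def dvd_iff)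
    ultimately show "(\<forall>s\<in>S. b dvd a * s) \<longleftrightarrow> (\<forall>h\<in>G. b dvd a * h)"
      by simp
  qed
  moreover have "finite G" using F(1) by (simp add: G_def)
  ultimately show "\<exists>G. finite G \<and> same_dual S G" by blast
qed

section \<open>Ascent from \<open>R\<close> to \<open>R[X]\<close>\<close>

text \<open>\<open>g\<close> is a greatest common divisor of \<open>S\<close> over the quotient
  field of the coefficients, found as a nonzero element of least degree in the divisorial closure
  \<open>I\<close> of \<open>S\<close>.\<close>

lemma ex_pseudo_gcd:
  fixes S :: "'a::idom poly set"
  assumes "\<not> S \<subseteq> {0}"
  obtains g where "g \<noteq> 0"
    "\<And>a b. b \<noteq> 0 \<Longrightarrow> (\<And>s. s \<in> S \<Longrightarrow> b dvd a * s) \<Longrightarrow> b dvd a * g"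
    "\<And>s. s \<in> S \<Longrightarrow> \<exists>c q. c \<noteq> 0 \<and> smult c s = g * q"
proof -
  define I where "I = {g. \<forall>a b. b \<noteq> 0 \<longrightarrow> (\<forall>s\<in>S. b dvd a * s) \<longrightarrow> b dvd a * g}"
  have S: "S \<subseteq> I" by (auto simp: I_def)
  then have "\<exists>g. g \<in> I \<and> g \<noteq> 0" using assms by blast
  then obtain g where g: "g \<in> I" "g \<noteq> 0"
    and min: "\<And>h. h \<in> I \<Longrightarrow> h \<noteq> 0 \<Longrightarrow> degree g \<le> degree h"
    using exists_least_lemma ex_has_least_nat[of "\<lambda>g. g \<in> I \<and> g \<noteq> 0" _ degree] by metis
  have "\<exists>c q. c \<noteq> 0 \<and> smult c s = g * q" if s: "s \<in> S" for s
  proof -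
    define r where "r = pseudo_mod s g"
    obtain c q where c: "c \<noteq> 0" "smult c s = g * q + r"
      using pseudo_mod(1)[OF g(2), of s] unfolding r_def by blast
    then have r: "r = [:c:] * s - g * q" by simp
    \<comment> \<open>The pseudo-remainder is a combination of \<open>s\<close> and
      \<open>g\<close>, hence in \<open>I\<close>; minimality of the degree of \<open>g\<close> then
      forces it to vanish.\<close>
    have "r \<in> I"
      unfolding I_def
    proof (intro CollectI allI impI)
      fix a b assume b: "b \<noteq> 0" "\<forall>s\<in>S. b dvd a * s"
      then have "b dvd [:c:] * (a * s) - q * (a * g)"
        using s g(1) by (intro dvd_diff[OF dvd_mult dvd_mult]) (auto simp: I_def)
      also have "[:c:] * (a * s) - q * (a * g) = a * r"
        by (simp only: r) (simp add: algebra_simps)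
      finally show "b dvd a * r" .
    qed
    then have "r = 0"
      using pseudo_mod(2)[OF g(2), of s] min unfolding r_def by (meson not_le)
    then show ?thesis using c by auto
  qed
  then show thesis
    using that[of g] g by (auto simp: I_def)
qed

text \<open>If \<open>b\<close> divides \<open>a * g\<close>, with quotient \<open>p\<close>, the
  test of \<open>S\<close> by \<open>a\<close> and \<open>b\<close> becomes a test of the
  coefficients of \<open>p\<close> against \<open>T\<close>. Dual compactness of \<open>R\<close>
  replaces \<open>T\<close> by a finite \<open>H\<close>, and multiplying by \<open>g / e\<close>
  carries \<open>H\<close> back to polynomials.\<close>

lemma dually_compact_poly:
  assumes ic: "integrally_closed_domain TYPE('a::idom)" and dc: "dually_compact TYPE('a)"
  shows "dually_compact TYPE('a poly)"
  unfolding dually_compact_iff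
proof
  fix S :: "'a poly set"
  show "\<exists>F. finite F \<and> same_dual S F"
  proof (cases "S \<subseteq> {0}")
    case True
    then show ?thesis by (intro exI[of _ "{}"]) (auto simp: same_dual_def)
  next
    case False
    then obtain g where g: "g \<noteq> 0"
      and dual: "\<And>a b. b \<noteq> 0 \<Longrightarrow> (\<And>s. s \<in> S \<Longrightarrow> b dvd a * s) \<Longrightarrow> b dvd a * g"
      and quot: "\<And>s. s \<in> S \<Longrightarrow> \<exists>c q. c \<noteq> 0 \<and> smult c s = g * q"
      using ex_pseudo_gcd by metis
    define e where "e = lead_coeff g"
    have e: "e \<noteq> 0" using g by (simp add: e_def)
    \<comment> \<open>\<open>e\<close> times the coefficients of the quotients \<open>s / g\<close>: by integral closedness \<open>e\<close> clears
      their denominators.\<close>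
    define T where "T = {t. \<exists>s\<in>S. \<exists>c q j. c \<noteq> 0 \<and> smult c s = g * q \<and> c * t = e * coeff q j}"
    obtain H where H: "finite H" "same_dual T H"
      using dc unfolding dually_compact_iff by blast
    have dvd_coeffs: "c dvd coeff g i * coeff q j" if "c \<noteq> 0" "smult c s = g * q" for c s q i j
    proof -
      have "[:c:] dvd g * q" using that(2)[symmetric] by (auto intro: dvdI[of _ _ s])
      then show ?thesis using const_dvd_coeff_products[OF ic that(1)] by blast
    qed
    have T: "(\<forall>s\<in>S. b dvd a * s) \<longleftrightarrow> (\<forall>i. \<forall>t\<in>T. e dvd coeff p i * t)"
      if b: "b \<noteq> 0" and p: "a * g = b * p" for a b p
    proof -
      \<comment> \<open>Both sides say that \<open>a s / b = p q / c\<close> is a polynomial over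
        \<open>R\<close>.\<close>
      have 1: "b dvd a * s \<longleftrightarrow> [:c:] dvd p * q" if c: "c \<noteq> 0" "smult c s = g * q" for c s q
      proof -
        have gq: "g * q = [:c:] * s" using c(2) by simp
        have "g * (b * (p * q)) = b * p * (g * q)" by (simp only: mult_ac)
        also have "\<dots> = a * g * ([:c:] * s)" by (simp only: p gq)
        also have "\<dots> = g * (a * s * [:c:])" by (simp only: mult_ac)
        finally have "b * (p * q) = a * s * [:c:]"
          using g by (simp only: mult_cancel_left) simp
        then have "b dvd a * s \<longleftrightarrow> b * [:c:] dvd b * (p * q)"
          using c(1) by (simp only: dvd_mult_cancel_right) simp
        then show ?thesis using b by (simp only: dvd_mult_cancel_left) simp
      qed
      have 2: "e dvd coeff p i * t \<longleftrightarrow> c dvd coeff p i * coeff q j"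
        if c: "c \<noteq> 0" "c * t = e * coeff q j" for c q t i j
      proof -
        have "e dvd coeff p i * t \<longleftrightarrow> c * e dvd coeff p i * (c * t)"
          using c(1) by (simp add: mult.left_commute[of _ c])
        also have "\<dots> \<longleftrightarrow> e * c dvd e * (coeff p i * coeff q j)"
          by (simp add: c(2) mult_ac)
        finally show ?thesis using e by simp
      qed
      show ?thesis
      proof (intro iffI allI ballI)
        fix i t assume *: "\<forall>s\<in>S. b dvd a * s" and "t \<in> T"
        then obtain s c q j where s: "s \<in> S" "c \<noteq> 0" "smult c s = g * q" "c * t = e * coeff q j"
          by (auto simp: T_def)
        then have "[:c:] dvd p * q" using * 1 by blast
        then show "e dvd coeff p i * t"
          using const_dvd_coeff_products[OF ic s(2)] 2[OF s(2,4)] by blast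
      next
        fix s assume *: "\<forall>i. \<forall>t\<in>T. e dvd coeff p i * t" and s: "s \<in> S"
        obtain c q where c: "c \<noteq> 0" "smult c s = g * q"
          using quot[OF s] by blast
        have "c dvd coeff p i * coeff q j" for i j
        proof -
          \<comment> \<open>The leading coefficient \<open>e\<close> of \<open>g\<close> is one
            factor of a coefficient product divisible by \<open>c\<close>, so
            \<open>e q_j / c\<close> lies in \<open>R\<close>.\<close>
          obtain t where t: "c * t = e * coeff q j"
            using dvd_coeffs[OF c, of "degree g" j] unfolding e_def by (metis dvdE)
          then have "t \<in> T" using s c by (auto simp: T_def)
          then show ?thesis using * 2[OF c(1) t] by blast
        qed
        then have "[:c:] dvd p * q"
          by (auto simp: const_poly_dvd_iff coeff_mult intro!: dvd_sum)
        then show "b dvd a * s" using 1[OF c] by blast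
      qed
    qed
    have H_iff: "(\<forall>i. \<forall>t\<in>T. e dvd coeff p i * t) \<longleftrightarrow> (\<forall>h\<in>H. [:e:] dvd smult h p)" for p
    proof -
      have "[:e:] dvd smult h p \<longleftrightarrow> (\<forall>i. e dvd coeff p i * h)" for h
        by (simp add: const_poly_dvd_iff mult.commute)
      then show ?thesis using same_dualD[OF H(2) e] by blast
    qed
    \<comment> \<open>The equivalence for \<open>a = b = 1\<close> and \<open>p = g\<close> holds
      with a trivial left side, so \<open>h g / e\<close> is a polynomial over
      \<open>R\<close>.\<close>
    have Hg: "\<exists>k. smult e k = smult h g" if "h \<in> H" for h
    proof -
      have "\<forall>i. \<forall>t\<in>T. e dvd coeff g i * t"
        using T[of 1 1 g] by simp
      then have "[:e:] dvd smult h g" using H_iff that by blast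
      then show ?thesis by (auto simp: dvd_def)
    qed
    define F where "F = insert g {k. \<exists>h\<in>H. smult e k = smult h g}"
    have "{k. \<exists>h\<in>H. smult e k = smult h g} = smult e -` (\<lambda>h. smult h g) ` H"
      by auto
    moreover have "inj (smult e)"
      using e by (auto simp: inj_on_def poly_eq_iff)
    ultimately have "finite F"
      using H(1) by (simp add: F_def finite_vimageI)
    moreover have "same_dual S F"
      unfolding same_dual_def
    proof (intro allI impI)
      fix a b :: "'a poly" assume b: "b \<noteq> 0"
      show "(\<forall>s\<in>S. b dvd a * s) \<longleftrightarrow> (\<forall>h\<in>F. b dvd a * h)"
      proof (cases "b dvd a * g")
        \<comment> \<open>The test then fails on both sides: on \<open>F\<close> because it contains
          \<open>g\<close>, on \<open>S\<close> because \<open>g\<close> passes every test that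
          \<open>S\<close> passes.\<close>
        case False
        then show ?thesis using dual[OF b] by (auto simp: F_def)
      next
        case True
        then obtain p where p: "a * g = b * p" by blast
        \<comment> \<open>Both sides say that \<open>a k / b = h p / e\<close> is a polynomial over
          \<open>R\<close>.\<close>
        have k_iff: "b dvd a * k \<longleftrightarrow> [:e:] dvd smult h p" if k: "smult e k = smult h g" for h k
        proof -
          have "[:e:] * (a * k) = a * smult e k" by simp
          also have "\<dots> = b * smult h p" by (simp add: k p)
          finally have eq: "[:e:] * (a * k) = b * smult h p" .
          have "b dvd a * k \<longleftrightarrow> [:e:] * b dvd [:e:] * (a * k)"
            using e by (simp only: dvd_mult_cancel_left) simp
          also have "\<dots> \<longleftrightarrow> b * [:e:] dvd b * smult h p"
            by (simp only: eq mult.commute[of "[:e:]" b])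
          finally show ?thesis using b by (simp only: dvd_mult_cancel_left) simp
        qed
        have "(\<forall>h\<in>H. [:e:] dvd smult h p)
            \<longleftrightarrow> (\<forall>k. (\<exists>h\<in>H. smult e k = smult h g) \<longrightarrow> b dvd a * k)"
          using Hg k_iff by metis
        also have "\<dots> \<longleftrightarrow> (\<forall>h\<in>F. b dvd a * h)"
          using True by (simp add: F_def)
        finally have "(\<forall>h\<in>H. [:e:] dvd smult h p) \<longleftrightarrow> (\<forall>h\<in>F. b dvd a * h)" .
        then show ?thesis using T[OF b p] H_iff by simp
      qed
    qed
    ultimately show ?thesis by blast
  qed
qed

theorem theorem4p4:
  assumes "integrally_closed_domain TYPE('a::idom)"
  shows "dually_compact TYPE('a poly) \<longleftrightarrow> dually_compact TYPE('a)"
  using dually_compact_of_poly dually_compact_poly[OF assms] by blast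

end
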